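(* For $p\in\mathbb{N}_0$ and all $n\in\mathbb{N}$, \begin{align*} \sum_{m=1}^nm^pH_{m-1}H_{m-1}(2)=&H_n(-p)H_nH_n(2)-\frac{B_p}{2}H_n^2+\Big(D^{(p)}(B)-C^{(p)}_1(n)-\frac p2B_{p-1}\Big)H_n\\ &-\Big(C^{(p)}_0(n)+\frac{B_p}{2}\Big)H_n(2)+C^{(p)}_{0,1}(n)+C^{(p)}_{1,1}(n)-C^{(p)}_2(n). \end{align*}
   Context: $H_m(k)=\sum_{j=1}^mj^{-k}$, $H_m=H_m(1)$ (empty sums $=0$), and $H_n(-p)=\sum_{m=1}^nm^p$. Bernoulli numbers: $\frac{te^t}{e^t-1}=\sum_{j\ge0}B_j\frac{t^j}{j!}$; the term $\frac p2B_{p-1}$ is $0$ when $p=0$. For $p\in\mathbb{N}_0$, $r\ge1$, $a_2,\dots,a_r\in\mathbb{N}_0$ and $a_1=0$, $$C^{(p)}_{a_2,\dots,a_r}(x)=\sum_{\substack{j_1,\dots,j_r\ge0\\ j_1+\dots+j_r\le p-a_r}}\Big(\prod_{i=1}^r\frac{\binom{p+1-a_i-j_1-\dots-j_{i-1}}{j_i}B_{j_i}}{p+1-a_i-j_1-\dots-j_{i-1}}\Big)x^{p+1-a_r-j_1-\dots-j_r}$$ (empty sum $=0$); for $r=1$ this is $C^{(p)}(x)=\sum_{j=0}^p\binom{p+1}{j}\frac{B_j}{p+1}x^{p+1-j}$. Since all exponents of $x$ are $\ge1$, $D^{(p)}_{a_2,\dots,a_r}(x):=C^{(p)}_{a_2,\dots,a_r}(x)/x$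 is a polynomial; $D^{(p)}(B)$ denotes the number obtained from the polynomial $D^{(p)}(x)$ by replacing each $x^i$ with $B_i$ (umbral convention). *)

theory Defs
  imports Complex_Main "HOL-Computational_Algebra.Computational_Algebra"
begin

definition gen_harm :: "nat \<Rightarrow> int \<Rightarrow> real" where
  "gen_harm m k = (\<Sum>j=1..m. real j powi (- k))"

text \<open>The exponential generating function is \<open>t * e^t / (e^t - 1)\<close>, so \<open>B\<^sub>1 = + 1/2\<close>.\<close>

definition bernoulli_num :: "nat \<Rightarrow> real" where
  "bernoulli_num j = fact j * fps_nth (fps_X * fps_exp 1 / (fps_exp 1 - 1)) j"

text \<open>
  The list \<open>as\<close> is \<open>[a\<^sub>2, \<dots>, a\<^sub>r]\<close>, so that \<open>r = length as + 1\<close>, and \<open>0 # as\<close> is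
  \<open>[a\<^sub>1, \<dots>, a\<^sub>r]\<close>; \<open>js\<close> is \<open>[j\<^sub>1, \<dots>, j\<^sub>r]\<close>. List positions start at 0, so position \<open>i\<close>
  belongs to the subscript \<open>i + 1\<close>, and \<open>C_arg p as js i\<close> is
  \<open>p + 1 - a\<^sub>i\<^sub>+\<^sub>1 - j\<^sub>1 - \<dots> - j\<^sub>i\<close>. It is an integer because for some \<open>as\<close>
  (with \<open>a\<^sub>i > a\<^sub>r\<close>, \<open>i < r\<close>) it can be nonpositive; hence also the generalised binomial
  coefficient below. The condition \<open>j\<^sub>1 + \<dots> + j\<^sub>r \<le> p - a\<^sub>r\<close> is written without subtraction;
  under it the subtraction in the exponent is not truncated.
\<close>

definition C_arg :: "nat \<Rightarrow> nat list \<Rightarrow> nat list \<Rightarrow> nat \<Rightarrow> int" where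
  "C_arg p as js i = int p + 1 - int ((0 # as) ! i) - int (sum_list (take i js))"

definition C_index :: "nat \<Rightarrow> nat list \<Rightarrow> nat list set" where
  "C_index p as = {js. length js = length (0 # as) \<and> sum_list js + last (0 # as) \<le> p}"

definition C_poly :: "nat \<Rightarrow> nat list \<Rightarrow> real poly" where
  "C_poly p as =
     (\<Sum>js\<in>C_index p as.
        monom (\<Prod>i<length (0 # as).
                 (real_of_int (C_arg p as js i) gchoose (js ! i)) * bernoulli_num (js ! i)
                   / real_of_int (C_arg p as js i))
              (p + 1 - last (0 # as) - sum_list js))"

lemma finite_C_index: "finite (C_index p as)"
proof (rule finite_subset)
  show "C_index p as \<subseteq> {js. set js \<subseteq> {..p} \<and> length js = length (0 # as)}"
    by (force simp: C_index_def dest: member_le_sum_list)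
  show "finite {js. set js \<subseteq> {..p} \<and> length js = length (0 # as)}"
    by (rule finite_lists_length_eq) simp
qed

definition D_poly :: "nat \<Rightarrow> nat list \<Rightarrow> real poly" where
  "D_poly p as = C_poly p as div [:0, 1:]"

lemma D_poly_exact: "[:0, 1:] * D_poly p as = C_poly p as"
proof -
  have "poly (C_poly p as) 0 = 0"
    by (auto simp: C_poly_def poly_sum poly_monom C_index_def intro!: sum.neutral)
  then have "[:0, 1:] dvd C_poly p as"
    by (simp add: poly_eq_0_iff_dvd)
  then show ?thesis
    unfolding D_poly_def by (rule dvd_mult_div_cancel)
qed

definition umbral :: "real poly \<Rightarrow> real" where
  "umbral q = (\<Sum>i\<le>degree q. coeff q i * bernoulli_num i)"

end

theory Submission
  imports Defs
begin

text \<open>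
  Each coefficient sequence \<open>a\<^sub>2, \<dots>, a\<^sub>r\<close> encodes an iterated summation: by Faulhaber's
  formula, \<open>C\<^sup>(\<^sup>p\<^sup>)(n)\<close> is the power sum \<open>H\<^sub>n(-p)\<close>, and appending \<open>b\<close> to a sequence ending in
  \<open>a \<le> b\<close> means dividing by \<open>m\<close> to the power \<open>b - a + 1\<close> and summing over \<open>m \<le> n\<close>, where the
  part of the quotient with negative exponents is dropped (so it reappears as a combination of
  harmonic numbers). This expresses all polynomials in the theorem by iterated sums of
  \<open>H\<^sub>m(-p)\<close>, and both sides then have the same increments in \<open>n\<close>.
\<close>

section \<open>Faulhaber's formula\<close>

text \<open>The quotient is exact: numerator and denominator both have subdegree 1, so the
  denominator divides the numerator.\<close>

lemma bernoulli_fps_mult: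
  "(fps_X * fps_exp 1 / (fps_exp 1 - 1)) * (fps_exp 1 - 1) = (fps_X * fps_exp 1 :: real fps)"
proof -
  define g where "g = (fps_exp 1 - 1 :: real fps)"
  have "g $ 0 = 0" "g $ 1 \<noteq> 0" by (simp_all add: g_def)
  then have "subdegree g = 1" by (intro subdegreeI) auto
  moreover from this have "g \<noteq> 0" by auto
  ultimately have "g dvd fps_X * fps_exp 1"
    by (subst fps_dvd_iff) (auto simp: subdegree_mult)
  then show ?thesis by (simp add: g_def)
qed

text \<open>A geometric sum in \<open>fps_exp 1\<close>. The factor \<open>fps_exp 1\<close> in the
  numerator, that is B_1 = +1/2, makes the exponentials run over m = 1..n instead of 0..n-1.\<close>

lemma bernoulli_fps_mult_exp:
  fixes f :: "real fps"
  assumes "f * (fps_exp 1 - 1) = fps_X * fps_exp 1"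
  shows "f * (fps_exp (real n) - 1) = fps_X * (\<Sum>m=1..n. fps_exp (real m))"
proof (induction n)
  case (Suc n)
  have "f * (fps_exp (real (Suc n)) - 1)
      = f * (fps_exp 1 - 1) * fps_exp (real n) + f * (fps_exp (real n) - 1)"
    by (simp add: fps_exp_add_mult algebra_simps)
  also have "\<dots> = fps_X * (fps_exp 1 * fps_exp (real n)) + fps_X * (\<Sum>m=1..n. fps_exp (real m))"
    by (simp only: assms Suc.IH mult.assoc)
  also have "\<dots> = fps_X * (\<Sum>m=1..Suc n. fps_exp (real m))"
    by (simp add: fps_exp_add_mult algebra_simps)
  finally show ?case .
qed simp

lemma faulhaber:
  "(\<Sum>m=1..n. real m ^ p)
    = (\<Sum>j\<le>p. real (Suc p choose j) * bernoulli_num j / real (Suc p) * real n ^ (Suc p - j))"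
proof -
  define f where "f = (fps_X * fps_exp 1 / (fps_exp 1 - 1) :: real fps)"
  have f: "f $ j = bernoulli_num j / fact j" for j
    by (simp add: f_def bernoulli_num_def)
  have "(\<Sum>m=1..n. real m ^ p) / fact p = (fps_X * (\<Sum>m=1..n. fps_exp (real m))) $ Suc p"
    by (simp add: fps_sum_nth sum_divide_distrib)
  also have "\<dots> = (f * (fps_exp (real n) - 1)) $ Suc p"
    using bernoulli_fps_mult by (simp add: f_def bernoulli_fps_mult_exp)
  \<comment> \<open>The constant term of \<open>fps_exp (real n) - 1\<close> is 0, which removes the
    index p + 1.\<close>
  also have "\<dots> = (\<Sum>j\<le>p. f $ j * (real n ^ (Suc p - j) / fact (Suc p - j)))"
    by (auto simp: fps_mult_nth atLeast0AtMost intro!: sum.cong)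
  finally have "(\<Sum>m=1..n. real m ^ p)
      = (\<Sum>j\<le>p. fact p * (f $ j * (real n ^ (Suc p - j) / fact (Suc p - j))))"
    by (simp add: field_simps sum_distrib_left)
  also have "\<dots> = (\<Sum>j\<le>p. real (Suc p choose j) * bernoulli_num j / real (Suc p) * real n ^ (Suc p - j))"
  proof (rule sum.cong)
    fix j assume "j \<in> {..p}"
    then have "real (Suc p choose j) = fact (Suc p) / (fact j * fact (Suc p - j))"
      by (intro binomial_fact) auto
    then show "fact p * (f $ j * (real n ^ (Suc p - j) / fact (Suc p - j)))
        = real (Suc p choose j) * bernoulli_num j / real (Suc p) * real n ^ (Suc p - j)"
      by (simp add: f divide_simps del: of_nat_Suc)
  qed simp
  finally show ?thesis .
qed

section \<open>The polynomials as iterated sums\<close>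

definition C_weight :: "nat \<Rightarrow> nat list \<Rightarrow> nat list \<Rightarrow> real" where
  "C_weight p as js = (\<Prod>i<length (0 # as).
     (real_of_int (C_arg p as js i) gchoose (js ! i)) * bernoulli_num (js ! i)
       / real_of_int (C_arg p as js i))"

lemma C_poly_eq:
  "C_poly p as = (\<Sum>js\<in>C_index p as. monom (C_weight p as js) (p + 1 - last (0 # as) - sum_list js))"
  by (simp add: C_poly_def C_weight_def)

lemma C_index_Nil: "C_index p [] = (\<lambda>j. [j]) ` {..p}"
  by (auto simp: C_index_def length_Suc_conv)

lemma C_weight_Nil:
  "C_weight p [] [j] = real (Suc p choose j) * bernoulli_num j / real (Suc p)"
  by (simp add: C_weight_def C_arg_def binomial_gbinomial add.commute)

lemma C_poly_Nil:
  "C_poly p [] = (\<Sum>j\<le>p. monom (C_weight p [] [j]) (Suc p - j))"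
  unfolding C_poly_eq C_index_Nil
  by (subst sum.reindex) (auto simp: inj_on_def)

lemma coeff_C_poly_Nil:
  assumes "0 < e" "e \<le> Suc p"
  shows "coeff (C_poly p []) e = C_weight p [] [Suc p - e]"
proof -
  have "coeff (C_poly p []) e = (\<Sum>j\<le>p. if j = Suc p - e then C_weight p [] [j] else 0)"
    using assms unfolding C_poly_Nil coeff_sum by (intro sum.cong) auto
  also have "\<dots> = C_weight p [] [Suc p - e]"
    using assms by (subst sum.delta) auto
  finally show ?thesis .
qed

text \<open>The two lowest coefficients are what turns into negative powers on division by x^2 or
  x^3; they produce the terms with B_p and B_{p-1} in the theorem.\<close>

lemma coeff_C_poly_Nil_1: "coeff (C_poly p []) 1 = bernoulli_num p"
  by (simp add: coeff_C_poly_Nil C_weight_Nil del: of_nat_Suc)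

lemma coeff_C_poly_Nil_2: "coeff (C_poly p []) 2 = real p / 2 * bernoulli_num (p - 1)"
proof (cases p)
  \<comment> \<open>Here the polynomial is x, and the factor p = 0 kills the right-hand side
    although \<open>p - 1\<close> truncates to 0.\<close>
  case 0
  then show ?thesis by (simp add: C_poly_Nil)
next
  case (Suc q)
  have *: "real (Suc (Suc q) choose q) / real (Suc (Suc q)) = real (Suc q) / 2"
    by (simp add: binomial_fact divide_simps del: binomial_Suc_Suc of_nat_Suc)
  have "coeff (C_poly p []) 2 = C_weight p [] [q]"
    using Suc by (simp add: coeff_C_poly_Nil)
  also have "\<dots> = real (Suc (Suc q) choose q) / real (Suc (Suc q)) * bernoulli_num q"
    by (simp add: C_weight_Nil Suc del: binomial_Suc_Suc of_nat_Suc)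
  finally show ?thesis
    unfolding * by (simp add: Suc)
qed

lemma poly_C_poly_Nil: "poly (C_poly p []) (real n) = (\<Sum>m=1..n. real m ^ p)"
  unfolding faulhaber by (simp add: C_poly_Nil poly_sum poly_monom C_weight_Nil)

lemma poly_C_poly_0: "poly (C_poly p as) 0 = 0"
  by (auto simp: C_poly_eq poly_sum poly_monom C_index_def intro!: sum.neutral)

text \<open>The bound \<open>b\<close> takes the place of the last entry of \<open>as\<close>: these
  are the tuples whose monomial keeps a nonnegative exponent after the division that precedes the
  next summation.\<close>

definition C_index_le :: "nat \<Rightarrow> nat list \<Rightarrow> nat \<Rightarrow> nat list set" where
  "C_index_le p as b = {js. length js = length (0 # as) \<and> sum_list js + b \<le> p}"

lemma C_index_eq_le: "C_index p as = C_index_le p as (last (0 # as))"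
  by (simp add: C_index_def C_index_le_def)

lemma C_index_le_Nil_0: "C_index_le p [] 0 = (\<lambda>j. [j]) ` {..p}"
  using C_index_eq_le[of p "[]"] C_index_Nil[of p] by simp

lemma finite_C_index_le: "finite (C_index_le p as b)"
proof -
  have "C_index_le p as b \<subseteq> C_index_le p as 0" by (auto simp: C_index_le_def)
  \<comment> \<open>\<open>C_index\<close> sees only the length and the last entry of the list, so
    an all-zero list realises the bound 0.\<close>
  also have "C_index_le p as 0 = C_index p (map (\<lambda>_. 0) as)"
    by (simp add: C_index_def C_index_le_def last_map)
  finally show ?thesis by (rule finite_subset) (rule finite_C_index)
qed

lemma C_index_snoc:
  "C_index p (as @ [b])
    = (\<lambda>(js, j). js @ [j]) ` (SIGMA js:C_index_le p as b. {..p - b - sum_list js})"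
  (is "?L = ?R")
proof
  show "?L \<subseteq> ?R"
  proof
    fix ks assume ks: "ks \<in> ?L"
    then have "ks \<noteq> []" by (auto simp: C_index_def)
    then obtain js j where "ks = js @ [j]" by (metis append_butlast_last_id)
    with ks show "ks \<in> ?R"
      by (force simp: C_index_def C_index_le_def)
  qed
qed (auto simp: C_index_def C_index_le_def)

text \<open>With q = p - b - \<open>sum_list js\<close>, which is exact under the assumption, the
  last argument is q + 1, so the last factor is a Faulhaber coefficient for exponent q. The earlier
  factors do not see the appended entries.\<close>

lemma C_weight_snoc:
  assumes "js \<in> C_index_le p as b"
  shows "C_weight p (as @ [b]) (js @ [j])
    = C_weight p as js * C_weight (p - b - sum_list js) [] [j]"
proof -
  have len: "length js = Suc (length as)" and le: "sum_list js + b \<le> p"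
    using assms by (auto simp: C_index_le_def)
  have "C_arg p (as @ [b]) (js @ [j]) i = C_arg p as js i" if "i < Suc (length as)" for i
    using that len by (auto simp: C_arg_def nth_append nth_Cons split: nat.splits)
  moreover have "C_arg p (as @ [b]) (js @ [j]) (Suc (length as))
      = C_arg (p - b - sum_list js) [] [j] 0"
    using len le by (simp add: C_arg_def nth_append)
  ultimately show ?thesis
    using len by (simp add: C_weight_def nth_append lessThan_Suc[of 0]
        prod.lessThan_Suc[of _ "Suc (length as)"] del: prod.lessThan_Suc)
qed

text \<open>For fixed \<open>js\<close>, summing over the last index alone assembles a full
  Faulhaber polynomial.\<close>

lemma C_poly_snoc:
  "C_poly p (as @ [b])
    = (\<Sum>js\<in>C_index_le p as b. smult (C_weight p as js) (C_poly (p - b - sum_list js) []))"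
proof -
  have "C_poly p (as @ [b]) = (\<Sum>(js, j)\<in>(SIGMA js:C_index_le p as b. {..p - b - sum_list js}).
      monom (C_weight p (as @ [b]) (js @ [j])) (p + 1 - b - sum_list (js @ [j])))"
    unfolding C_poly_eq C_index_snoc
    by (subst sum.reindex) (auto simp: inj_on_def case_prod_beta intro!: sum.cong)
  also have "\<dots> = (\<Sum>js\<in>C_index_le p as b. \<Sum>j\<le>p - b - sum_list js.
      monom (C_weight p (as @ [b]) (js @ [j])) (p + 1 - b - sum_list (js @ [j])))"
    by (subst sum.Sigma) (auto simp: finite_C_index_le)
  also have "\<dots> = (\<Sum>js\<in>C_index_le p as b. smult (C_weight p as js) (C_poly (p - b - sum_list js) []))"
  proof (rule sum.cong)
    fix js assume js: "js \<in> C_index_le p as b"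
    then have "p + 1 - b - sum_list (js @ [j]) = Suc (p - b - sum_list js) - j" for j
      by (simp add: C_index_le_def Suc_diff_le)
    with js show "(\<Sum>j\<le>p - b - sum_list js.
          monom (C_weight p (as @ [b]) (js @ [j])) (p + 1 - b - sum_list (js @ [j])))
        = smult (C_weight p as js) (C_poly (p - b - sum_list js) [])"
      unfolding C_poly_Nil by (intro poly_eqI)
        (simp add: C_weight_snoc coeff_sum sum_distrib_left if_distrib cong: if_cong)
  qed simp
  finally show ?thesis .
qed

lemma poly_C_poly_snoc:
  "poly (C_poly p (as @ [b])) (real n)
    = (\<Sum>m=1..n. \<Sum>js\<in>C_index_le p as b. C_weight p as js * real m ^ (p - b - sum_list js))"
  unfolding C_poly_snoc poly_sum poly_smult poly_C_poly_Nil sum_distrib_left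
  by (rule sum.swap)

text \<open>Monomials of exponent above d stay polynomial after the division and form the first sum;
  those of exponent 1 to d become negative powers and form the second.\<close>

lemma poly_C_poly_div_power:
  fixes x :: real
  assumes ab: "last (0 # as) + d = b" and x: "x \<noteq> 0"
  shows "poly (C_poly p as) x / x ^ Suc d
    = (\<Sum>js\<in>C_index_le p as b. C_weight p as js * x ^ (p - b - sum_list js))
      + (\<Sum>e=1..d. coeff (C_poly p as) e / x ^ (Suc d - e))"
proof -
  define a where "a = last (0 # as)"
  define E where "E js = p + 1 - a - sum_list js" for js
  define I where "I = C_index p as"
  define J where "J = C_index_le p as b"
  define w where "w = C_weight p as"
  have fin: "finite I" and JI: "J \<subseteq> I"
    using ab by (auto simp: I_def J_def C_index_eq_le finite_C_index_le simp del: last.simps)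
      (auto simp: C_index_le_def simp del: last.simps)
  \<comment> \<open>A tuple has \<open>sum_list js\<close> > p - b exactly when its exponent, which
    is at least 1 on \<open>I\<close>, is at most b - a = d.\<close>
  have I_E: "js \<in> I - J \<longleftrightarrow> js \<in> I \<and> E js \<in> {1..d}" for js
    using ab by (auto simp: I_def J_def C_index_eq_le C_index_le_def E_def a_def simp del: last.simps)
  have "poly (C_poly p as) x / x ^ Suc d = (\<Sum>js\<in>I. w js * x ^ E js / x ^ Suc d)"
    by (simp add: C_poly_eq poly_sum poly_monom sum_divide_distrib I_def w_def E_def a_def
        del: last.simps power_Suc)
  also have "\<dots> = (\<Sum>js\<in>I - J. w js * x ^ E js / x ^ Suc d) + (\<Sum>js\<in>J. w js * x ^ E js / x ^ Suc d)"
    using fin JI by (rule sum.subset_diff[rotated])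
  also have "(\<Sum>js\<in>J. w js * x ^ E js / x ^ Suc d) = (\<Sum>js\<in>J. w js * x ^ (p - b - sum_list js))"
  proof (rule sum.cong)
    fix js assume "js \<in> J"
    then have "E js = (p - b - sum_list js) + Suc d"
      using ab by (auto simp: J_def C_index_le_def E_def a_def simp del: last.simps)
    then show "w js * x ^ E js / x ^ Suc d = w js * x ^ (p - b - sum_list js)"
      using x by (simp only: power_add) simp
  qed simp
  \<comment> \<open>Grouping the remaining tuples by exponent collects their weights into
    coefficients.\<close>
  also have "(\<Sum>js\<in>I - J. w js * x ^ E js / x ^ Suc d)
      = (\<Sum>e=1..d. \<Sum>js\<in>{js \<in> I - J. E js = e}. w js * x ^ E js / x ^ Suc d)"
    using fin I_E by (intro sum.group[symmetric]) blast+
  also have "\<dots> = (\<Sum>e=1..d. coeff (C_poly p as) e / x ^ (Suc d - e))"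
  proof (rule sum.cong)
    fix e assume e: "e \<in> {1..d}"
    have "coeff (C_poly p as) e = (\<Sum>js\<in>I. if E js = e then w js else 0)"
      unfolding C_poly_eq coeff_sum I_def E_def a_def w_def by simp
    also have "\<dots> = (\<Sum>js\<in>{js \<in> I. E js = e}. w js)"
      using fin by (simp add: sum.inter_filter)
    also have "{js \<in> I. E js = e} = {js \<in> I - J. E js = e}"
      using e I_E by blast
    finally have c: "coeff (C_poly p as) e = (\<Sum>js\<in>{js \<in> I - J. E js = e}. w js)" .
    have "x ^ Suc d = x ^ e * x ^ (Suc d - e)"
      using e by (simp flip: power_add)
    then have "x ^ e / x ^ Suc d = 1 / x ^ (Suc d - e)"
      using x by simp
    then have "(\<Sum>js\<in>{js \<in> I - J. E js = e}. w js * x ^ E js / x ^ Suc d)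
        = (\<Sum>js\<in>{js \<in> I - J. E js = e}. w js * (1 / x ^ (Suc d - e)))"
      by (intro sum.cong) (auto simp del: power_Suc simp flip: times_divide_eq_right)
    also have "\<dots> = coeff (C_poly p as) e / x ^ (Suc d - e)"
      by (simp add: c sum_divide_distrib)
    finally show "(\<Sum>js\<in>{js \<in> I - J. E js = e}. w js * x ^ E js / x ^ Suc d)
        = coeff (C_poly p as) e / x ^ (Suc d - e)" .
  qed simp
  finally show ?thesis by (simp add: J_def w_def add.commute)
qed

lemma poly_C_poly_Suc:
  assumes "last (0 # as) + d = b"
  shows "poly (C_poly p (as @ [b])) (real (Suc n))
    = poly (C_poly p (as @ [b])) (real n)
      + poly (C_poly p as) (real (Suc n)) / real (Suc n) ^ Suc d
      - (\<Sum>e=1..d. coeff (C_poly p as) e / real (Suc n) ^ (Suc d - e))"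
  unfolding poly_C_poly_snoc
  using poly_C_poly_div_power[OF assms, of "real (Suc n)" p] by simp

text \<open>Both sides are the sum of w_j B_{p-j} with w_j the Faulhaber coefficients: w_j belongs
  to x^{p-j} in D, while \<open>C_poly p [0]\<close> is the sum of w_j times the Faulhaber
  polynomial for p - j, whose linear coefficient is B_{p-j}.\<close>

lemma umbral_D_poly_Nil: "umbral (D_poly p []) = coeff (C_poly p [0]) 1"
proof -
  have coeff_D: "coeff (D_poly p []) i = coeff (C_poly p []) (Suc i)" for i
    by (simp flip: D_poly_exact)
  have "degree (C_poly p []) \<le> Suc p"
    unfolding C_poly_Nil by (intro degree_sum_le order_trans[OF degree_monom_le]) auto
  then have "degree (D_poly p []) \<le> p"
    by (intro degree_le) (auto simp: coeff_D coeff_eq_0)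
  then have "umbral (D_poly p []) = (\<Sum>i\<le>p. coeff (D_poly p []) i * bernoulli_num i)"
    unfolding umbral_def by (intro sum.mono_neutral_left) (auto simp: coeff_eq_0)
  also have "\<dots> = (\<Sum>i\<le>p. C_weight p [] [p - i] * bernoulli_num i)"
    by (intro sum.cong) (auto simp: coeff_D coeff_C_poly_Nil)
  also have "\<dots> = (\<Sum>j\<le>p. C_weight p [] [j] * bernoulli_num (p - j))"
    by (rule sum.reindex_bij_witness[of _ "\<lambda>j. p - j" "\<lambda>i. p - i"]) auto
  also have "\<dots> = coeff (C_poly p ([] @ [0])) 1"
    unfolding C_poly_snoc coeff_sum coeff_smult coeff_C_poly_Nil_1
    by (simp add: C_index_le_Nil_0 sum.reindex inj_on_def)
  finally show ?thesis by simp
qed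

section \<open>Summation by parts\<close>

lemma gen_harm_0: "gen_harm 0 k = 0"
  by (simp add: gen_harm_def)

lemma gen_harm_Suc: "gen_harm (Suc n) k = gen_harm n k + real (Suc n) powi (- k)"
  by (simp add: gen_harm_def)

lemma gen_harm_neg: "gen_harm n (- int p) = poly (C_poly p []) (real n)"
  by (simp add: gen_harm_def poly_C_poly_Nil power_int_def)

text \<open>
  Here \<open>x = n + 1\<close>, \<open>s = x\<^sup>p\<close>, \<open>P = p/2 * B\<^sub>p\<^sub>-\<^sub>1\<close>, and \<open>S\<close>, \<open>H\<close>, \<open>K\<close>, \<open>C0\<close>, \<open>C1\<close>, \<open>C2\<close>, \<open>C01\<close>,
  \<open>C11\<close> are the values at \<open>n\<close> of the power sum, the two harmonic numbers and the polynomials.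
\<close>

lemma increment_identity:
  fixes x :: real
  assumes "x \<noteq> 0"
  shows "(S + s) * (H + 1 / x) * (K + 1 / x^2) - B / 2 * (H + 1 / x)^2
      + (D - (C1 + (S + s) / x^2 - B / x) - P) * (H + 1 / x)
      - ((C0 + (S + s) / x) + B / 2) * (K + 1 / x^2)
      + (C01 + (C0 + (S + s) / x) / x^2 - D / x) + (C11 + (C1 + (S + s) / x^2 - B / x) / x)
      - (C2 + (S + s) / x^3 - (B / x^2 + P / x))
    = s * H * K + (S * H * K - B / 2 * H^2 + (D - C1 - P) * H - (C0 + B / 2) * K + C01 + C11 - C2)"
  using assms by (simp add: field_simps power2_eq_square power3_eq_cube)

theorem theorem2p7:
  fixes p n :: nat
  assumes "n \<ge> 1"
  shows "(\<Sum>m=1..n. real m ^ p * gen_harm (m - 1) 1 * gen_harm (m - 1) 2) =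
      gen_harm n (- int p) * gen_harm n 1 * gen_harm n 2
    - bernoulli_num p / 2 * (gen_harm n 1)^2
    + (umbral (D_poly p []) - poly (C_poly p [1]) (real n)
        - real p / 2 * bernoulli_num (p - 1)) * gen_harm n 1
    - (poly (C_poly p [0]) (real n) + bernoulli_num p / 2) * gen_harm n 2
    + poly (C_poly p [0, 1]) (real n) + poly (C_poly p [1, 1]) (real n)
    - poly (C_poly p [2]) (real n)"
proof (induction n)
  case 0
  \<comment> \<open>All harmonic sums are empty and the polynomials have no constant term.\<close>
  show ?case by (simp add: gen_harm_0 poly_C_poly_0)
next
  case (Suc n)
  define x where "x = real (Suc n)"
  define Q where "Q as = poly (C_poly p as)" for as
  have x: "x \<noteq> 0" by (simp add: x_def)
  have S: "gen_harm (Suc n) (- int p) = gen_harm n (- int p) + x ^ p"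
    by (simp add: gen_harm_Suc x_def power_int_def)
  have H: "gen_harm (Suc n) 1 = gen_harm n 1 + 1 / x"
    by (simp add: gen_harm_Suc x_def power_int_minus divide_inverse)
  have K: "gen_harm (Suc n) 2 = gen_harm n 2 + 1 / x^2"
    by (simp add: gen_harm_Suc x_def power_int_minus divide_inverse)
  have Q_Nil: "Q [] x = gen_harm n (- int p) + x ^ p"
    unfolding Q_def x_def gen_harm_neg[symmetric] by (simp add: S x_def)
  have Q0: "Q [0] x = Q [0] (real n) + (gen_harm n (- int p) + x ^ p) / x"
    \<comment> \<open>The second instantiated argument is d, the number of low coefficients dropped:
      none here and for \<open>Q11\<close>, one for \<open>Q1\<close> and \<open>Q01\<close>, two
      for \<open>Q2\<close>.\<close>
    using poly_C_poly_Suc[of "[]" 0 0 p n, folded x_def Q_def] by (simp add: Q_Nil)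
  have Q1: "Q [1] x = Q [1] (real n) + (gen_harm n (- int p) + x ^ p) / x^2 - bernoulli_num p / x"
    using poly_C_poly_Suc[of "[]" 1 1 p n, folded x_def Q_def] coeff_C_poly_Nil_1[of p]
    by (simp add: Q_Nil power2_eq_square)
  have Q2: "Q [2] x = Q [2] (real n) + (gen_harm n (- int p) + x ^ p) / x^3
      - (bernoulli_num p / x^2 + real p / 2 * bernoulli_num (p - 1) / x)"
  proof -
    have "{1..2} = {1, 2 :: nat}" by auto
    then show ?thesis
      using poly_C_poly_Suc[of "[]" 2 2 p n, folded x_def Q_def] coeff_C_poly_Nil_1[of p]
      by (simp add: Q_Nil coeff_C_poly_Nil_2 power2_eq_square power3_eq_cube mult.assoc)
  qed
  \<comment> \<open>The coefficient dropped here is the linear one of \<open>C_poly p [0]\<close>,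
    which is how D(B) enters.\<close>
  have Q01: "Q [0, 1] x = Q [0, 1] (real n) + Q [0] x / x^2 - umbral (D_poly p []) / x"
    using poly_C_poly_Suc[of "[0]" 1 1 p n, folded x_def Q_def]
    by (simp add: umbral_D_poly_Nil power2_eq_square)
  have Q11: "Q [1, 1] x = Q [1, 1] (real n) + Q [1] x / x"
    using poly_C_poly_Suc[of "[1]" 0 1 p n, folded x_def Q_def] by simp
  have "(\<Sum>m=1..Suc n. real m ^ p * gen_harm (m - 1) 1 * gen_harm (m - 1) 2)
      = x ^ p * gen_harm n 1 * gen_harm n 2
        + (\<Sum>m=1..n. real m ^ p * gen_harm (m - 1) 1 * gen_harm (m - 1) 2)"
    by (simp add: x_def)
  then show ?case
    unfolding Suc.IH x_def[symmetric] Q_def[symmetric] S H K Q01 Q11 Q0 Q1 Q2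
    by (simp only: increment_identity[OF x])
qed

end
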